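(* Let $\ell(\hat y,y)=(\hat y-y)^2$ be the squared loss and $\mathcal{Y}=[0,1]$. For every $n\ge 2$ and every $T\ge c_2\sqrt n/\log(n)$, where $c_2$ is the universal constant from Lecué and Mendelson (2013) described in the context, there exist $M\le n^{1/c_2}+2$, a dictionary $\mathcal{F}=\{f_1,\ldots,f_M\}$ with values in $[0,1]$, and a distribution $P$ on $\mathcal{X}\times[0,1]$ such that the aggregation with exponential weights (AEW) estimator $\hat f_T$ with temperature $T$ satisfies $$\mathbb{P}_{\mathbf{S}\sim P^n}\left(\mathcal{R}_P(\hat f_T)\ge\min_{1\le j\le M}\mathcal{R}_P(f_j)+\frac{1}{4\sqrt n}\right)=1.$$
   Context: $(\mathcal{X},\Sigma)$ is an abstract measurable space, and $\mathcal{Y}=[0,1]$ carries its Borel $\sigma$-algebra; distributions on $\mathcal{X}\times[0,1]$ are probability measures on the product $\sigma$-algebra. A dictionary $\mathcal{F}=\{f_1,\ldots,f_M\}$, with $M\in\mathbb{N}$, is a finite dictionary of measurable functions $f_k:\mathcal{X}\to[0,1]$. For a distribution $P$ on $\mathcal{X}\times[0,1]$, the risk of a measurable $f:\mathcal{X}\to[0,1]$ is $\mathcal{R}_P(f)=\mathbb{E}_{(X,Y)\sim P}[(f(X)-Y)^2]$. For a sample $\mathbf{S}=(X_i,Y_i)_{i=1}^n$, $n\in\mathbb{N}$, drawn i.i.d. from $P$ (i.e. $\mathbf{S}\sim P^n$), the empirical risk is $\widehat{\mathcal{R}}_{\mathbf{S}}(f)=\frac1n\sum_{i=1}^n(f(X_i)-Y_i)^2$.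 The AEW estimator with temperature $T>0$ is $$\hat f_T=\sum_{k=1}^M\hat\theta_k f_k,\qquad \hat\theta_k=\frac{\exp\left(-\frac{n}{T}\widehat{\mathcal{R}}_{\mathbf{S}}(f_k)\right)}{\sum_{j=1}^M\exp\left(-\frac{n}{T}\widehat{\mathcal{R}}_{\mathbf{S}}(f_j)\right)},\quad k\in\{1,\ldots,M\}.$$ The constant $c_2>0$ is the specific universal constant appearing in the lower bound in probability of Lecué and Mendelson (2013) for the AEW estimator with squared loss under random design: they show that, for any temperature $T\le c_2\sqrt n/\log(n)$, the AEW estimator is suboptimal (relative to the optimal rate of aggregation $\log(M)/n$) on an event of constant probability. Thus the range $T\ge c_2\sqrt n/\log(n)$ considered here is the complementary range of temperatures. $\log$ is the natural logarithm. *)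

theory Defs
  imports "HOL-Probability.Probability"
begin

definition sq_loss :: "real \<Rightarrow> real \<Rightarrow> real" where
  "sq_loss yhat y = (yhat - y)\<^sup>2"

definition unit_borel :: "real measure" where
  "unit_borel = restrict_space borel {0..1}"

definition data_distribution :: "'a measure \<Rightarrow> ('a \<times> real) measure \<Rightarrow> bool" where
  "data_distribution X P \<longleftrightarrow> prob_space P \<and> sets P = sets (X \<Otimes>\<^sub>M unit_borel)"

text \<open>A dictionary \<open>{f 1, \<dots>, f M}\<close> consists of \<open>M\<close> pairwise distinct functions; since functions
  are only meaningful on \<open>space X\<close>, distinctness is that of their restrictions to \<open>space X\<close>.\<close>

definition dictionary :: "'a measure \<Rightarrow> nat \<Rightarrow> (nat \<Rightarrow> 'a \<Rightarrow> real) \<Rightarrow> bool" where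
  "dictionary X M f \<longleftrightarrow>
     1 \<le> M \<and> (\<forall>k\<in>{1..M}. f k \<in> X \<rightarrow>\<^sub>M unit_borel) \<and>
     inj_on (\<lambda>k. restrict (f k) (space X)) {1..M}"

definition risk :: "('a \<times> real) measure \<Rightarrow> ('a \<Rightarrow> real) \<Rightarrow> real" where
  "risk P g = (LINT z|P. sq_loss (g (fst z)) (snd z))"

text \<open>A sample of size \<open>n\<close> is a function \<open>S\<close> on the index set \<open>{1..n}\<close>.\<close>

definition emp_risk :: "nat \<Rightarrow> (nat \<Rightarrow> 'a \<times> real) \<Rightarrow> ('a \<Rightarrow> real) \<Rightarrow> real" where
  "emp_risk n S g = (1 / real n) * (\<Sum>i=1..n. sq_loss (g (fst (S i))) (snd (S i)))"

definition iid_sample :: "nat \<Rightarrow> ('a \<times> real) measure \<Rightarrow> (nat \<Rightarrow> 'a \<times> real) measure" where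
  "iid_sample n P = PiM {1..n} (\<lambda>_. P)"

definition aew_weight ::
    "real \<Rightarrow> nat \<Rightarrow> nat \<Rightarrow> (nat \<Rightarrow> 'a \<Rightarrow> real) \<Rightarrow> (nat \<Rightarrow> 'a \<times> real) \<Rightarrow> nat \<Rightarrow> real" where
  "aew_weight T n M f S k =
     exp (- (real n / T) * emp_risk n S (f k)) /
     (\<Sum>j=1..M. exp (- (real n / T) * emp_risk n S (f j)))"

definition aew ::
    "real \<Rightarrow> nat \<Rightarrow> nat \<Rightarrow> (nat \<Rightarrow> 'a \<Rightarrow> real) \<Rightarrow> (nat \<Rightarrow> 'a \<times> real) \<Rightarrow> 'a \<Rightarrow> real" where
  "aew T n M f S x = (\<Sum>k=1..M. aew_weight T n M f S k * f k x)"

end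

theory Submission
  imports Defs
begin

text \<open>
  The lower bound needs no randomness. Let \<open>P\<close> be a point mass at a pair \<open>(x0, 0)\<close> and let all
  functions of the dictionary be constant. Almost surely every label of the sample is \<open>0\<close>, so the
  weight of a constant \<open>c\<close> is proportional to \<open>exp (- (n / T) * c\<^sup>2)\<close>, and the AEW estimator is a
  deterministic constant whose risk is its square.

  The dictionary consists of the perfect predictor \<open>0\<close> and of \<open>K\<close> predictors that are almost equal
  to \<open>a = n powr (-1/4)\<close>. Each bad predictor has unnormalised weight at least
  \<open>w = exp (- sqrt n / T)\<close>, against \<open>1\<close> for the perfect one. The assumed lower bound on the
  temperature says exactly that \<open>w \<ge> n powr (- 1 / c2)\<close>. Hence as soon as \<open>K > n powr (1 / c2)\<close> the
  bad predictors jointly outweigh the good one, the average is at least \<open>a / 2\<close>, and the excess risk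
  is at least \<open>(a / 2)\<^sup>2 = 1 / (4 * sqrt n)\<close>.

  The functions of a dictionary must be distinct, so the bad predictors cannot all equal \<open>a\<close>. The
  smallest integer \<open>K\<close> with \<open>K > n powr (1 / c2)\<close> still leaves room for one more function within the
  allowed size \<open>n powr (1 / c2) + 2\<close>, and the strict inequality \<open>K * w > 1\<close> pays for moving
  the bad predictors slightly and differently below \<open>a\<close>; moving them down only increases their
  weights.
\<close>

text \<open>
  Subtracting \<open>a / 2\<close> from every value turns the claim into a sign condition: the value \<open>0\<close> then
  contributes \<open>- a / 2\<close>, and the \<open>K\<close> other values have to compensate for it.
\<close>

lemma weighted_sum_ge_half:
  fixes p c :: "nat \<Rightarrow> real" and a w \<epsilon> :: real
  assumes "p 1 = 1" "c 1 = 0"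
    and p: "\<And>k. k \<in> {2..Suc K} \<Longrightarrow> w \<le> p k"
    and c: "\<And>k. k \<in> {2..Suc K} \<Longrightarrow> a - \<epsilon> \<le> c k"
    and "0 \<le> w" "\<epsilon> \<le> a / 2"
    and compensate: "a / 2 \<le> real K * w * (a / 2 - \<epsilon>)"
  shows "a / 2 * (\<Sum>k=1..Suc K. p k) \<le> (\<Sum>k=1..Suc K. p k * c k)"
proof -
  have split: "{1..Suc K} = insert 1 {2..Suc K}"
    by auto
  have "real K * (w * (a / 2 - \<epsilon>)) = (\<Sum>k=2..Suc K. w * (a / 2 - \<epsilon>))"
    by simp
  also have "\<dots> \<le> (\<Sum>k=2..Suc K. p k * (c k - a / 2))"
  proof (rule sum_mono)
    fix k assume k: "k \<in> {2..Suc K}"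
    show "w * (a / 2 - \<epsilon>) \<le> p k * (c k - a / 2)"
      using p[OF k] c[OF k] \<open>0 \<le> w\<close> \<open>\<epsilon> \<le> a / 2\<close> by (intro mult_mono) auto
  qed
  finally have "0 \<le> - a / 2 + (\<Sum>k=2..Suc K. p k * (c k - a / 2))"
    using compensate by simp
  also have "\<dots> = (\<Sum>k=1..Suc K. p k * (c k - a / 2))"
    unfolding split using assms(1,2) by simp
  also have "\<dots> = (\<Sum>k=1..Suc K. p k * c k) - a / 2 * (\<Sum>k=1..Suc K. p k)"
    by (simp only: right_diff_distrib sum_subtractf sum_distrib_left mult.commute)
  finally show ?thesis by simp
qed

text \<open>
  The distinct constants on which exponential weighting fails: \<open>0\<close> together with \<open>K\<close> values just
  below \<open>a\<close>, which beat it by their number.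
\<close>

lemma bad_constants_exist:
  fixes a b :: real
  assumes "0 < a" "0 \<le> b" and many: "1 < real K * exp (- b * a\<^sup>2)"
  obtains c :: "nat \<Rightarrow> real" where
    "c 1 = 0" "inj_on c {1..Suc K}" "c ` {1..Suc K} \<subseteq> {0..a}"
    "a / 2 \<le> (\<Sum>k=1..Suc K. exp (- b * (c k)\<^sup>2) * c k) / (\<Sum>k=1..Suc K. exp (- b * (c k)\<^sup>2))"
proof -
  define w where "w = exp (- b * a\<^sup>2)"
  \<comment> \<open>The largest displacement that the slack allows: it solves \<open>K * w * (a / 2 - \<epsilon>) = a / 2\<close>.\<close>
  define \<epsilon> where "\<epsilon> = a / 2 * (1 - 1 / (real K * w))"
  define c where "c k = (if k = 1 then 0 else a - \<epsilon> / real k)" for k :: nat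
  have Kw: "1 < real K * w"
    using many by (simp add: w_def)
  have "0 < \<epsilon>"
    using Kw \<open>0 < a\<close> by (simp add: \<epsilon>_def)
  have "\<epsilon> < a / 2"
  proof -
    have "1 - 1 / (real K * w) < 1" using Kw by simp
    then have "a / 2 * (1 - 1 / (real K * w)) < a / 2 * 1"
      using \<open>0 < a\<close> by (intro mult_strict_left_mono) auto
    then show ?thesis by (simp add: \<epsilon>_def)
  qed
  have c_bounds: "a - \<epsilon> \<le> c k" "c k \<le> a" if "k \<in> {2..Suc K}" for k
    using that \<open>0 < \<epsilon>\<close> by (auto simp: c_def field_simps)
  have inj: "inj_on c {1..Suc K}"
  proof (rule inj_onI)
    fix i j assume ij: "i \<in> {1..Suc K}" "j \<in> {1..Suc K}" "c i = c j"
    have pos: "0 < c k" if "k \<in> {1..Suc K}" "k \<noteq> 1" for k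
      using c_bounds(1)[of k] that \<open>\<epsilon> < a / 2\<close> \<open>0 < a\<close> by auto
    show "i = j"
    proof (cases "i = 1 \<or> j = 1")
      case True
      then show ?thesis
        using pos[of i] pos[of j] ij by (auto simp: c_def split: if_splits)
    next
      case False
      then show ?thesis
        using ij \<open>0 < \<epsilon>\<close> by (auto simp: c_def field_simps)
    qed
  qed
  have c_range: "c ` {1..Suc K} \<subseteq> {0..a}"
  proof
    fix y assume "y \<in> c ` {1..Suc K}"
    then obtain k where k: "k \<in> {1..Suc K}" "y = c k" by auto
    show "y \<in> {0..a}"
    proof (cases "k = 1")
      case True
      then show ?thesis using k \<open>0 < a\<close> by (simp add: c_def)
    next
      case False
      then have "k \<in> {2..Suc K}" using k by auto
      from c_bounds[OF this] show ?thesis using k \<open>\<epsilon> < a / 2\<close> by auto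
    qed
  qed
  have "a / 2 * (\<Sum>k=1..Suc K. exp (- b * (c k)\<^sup>2))
      \<le> (\<Sum>k=1..Suc K. exp (- b * (c k)\<^sup>2) * c k)"
  proof (rule weighted_sum_ge_half)
    show "w \<le> exp (- b * (c k)\<^sup>2)" if "k \<in> {2..Suc K}" for k
    proof -
      have "0 \<le> c k" using c_bounds(1)[OF that] \<open>\<epsilon> < a / 2\<close> \<open>0 < a\<close> by simp
      then have "(c k)\<^sup>2 \<le> a\<^sup>2" using c_bounds(2)[OF that] by (intro power_mono)
      then have "b * (c k)\<^sup>2 \<le> b * a\<^sup>2" using \<open>0 \<le> b\<close> by (rule mult_left_mono)
      then show ?thesis by (simp add: w_def)
    qed
    have "real K * w * (a / 2 - \<epsilon>) = a / 2"
      using Kw by (auto simp: \<epsilon>_def field_simps)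
    then show "a / 2 \<le> real K * w * (a / 2 - \<epsilon>)" by simp
  qed (use c_bounds \<open>\<epsilon> < a / 2\<close> in \<open>auto simp: w_def c_def\<close>)
  moreover have "0 < (\<Sum>k=1..Suc K. exp (- b * (c k)\<^sup>2))"
    by (intro sum_pos) auto
  ultimately have "a / 2 \<le> (\<Sum>k=1..Suc K. exp (- b * (c k)\<^sup>2) * c k) /
      (\<Sum>k=1..Suc K. exp (- b * (c k)\<^sup>2))"
    by (simp only: pos_le_divide_eq)
  moreover have "c 1 = 0" by (simp add: c_def)
  ultimately show thesis using that inj c_range by blast
qed

lemma aew_const_zero_labels:
  assumes "n \<noteq> 0" "\<And>i. i \<in> {1..n} \<Longrightarrow> snd (S i) = 0"
  shows "aew T n M (\<lambda>k _. c k) S x =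
    (\<Sum>k=1..M. exp (- (real n / T) * (c k)\<^sup>2) * c k) / (\<Sum>k=1..M. exp (- (real n / T) * (c k)\<^sup>2))"
proof -
  have "emp_risk n S (\<lambda>_. c k) = (c k)\<^sup>2" for k
    using assms by (simp add: emp_risk_def sq_loss_def)
  then show ?thesis
    by (simp add: aew_def aew_weight_def sum_divide_distrib)
qed

lemma measurable_snd_unit_borel: "snd \<in> borel_measurable (X \<Otimes>\<^sub>M unit_borel)"
  unfolding unit_borel_def
  by (rule measurable_compose[OF measurable_snd]) (simp add: measurable_restrict_space1)

lemma in_space_unit_borel_zero:
  "x0 \<in> space X \<Longrightarrow> (x0, 0) \<in> space (X \<Otimes>\<^sub>M unit_borel)"
  by (simp add: space_pair_measure unit_borel_def space_restrict_space)

lemma risk_point_mass_const: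
  assumes "x0 \<in> space X"
  shows "risk (return (X \<Otimes>\<^sub>M unit_borel) (x0, 0)) (\<lambda>_. v) = v\<^sup>2"
  unfolding risk_def sq_loss_def using measurable_snd_unit_borel[of X]
  by (subst integral_return) (auto simp: in_space_unit_borel_zero assms)

text \<open>
  Almost every sample has only labels \<open>0\<close>, and on such samples the prediction is deterministic.
  Samples with other labels do exist in the sample space, so the event need not be the whole space
  and has to be shown measurable: \<open>measure\<close> is \<open>0\<close> on non-measurable sets.
\<close>

lemma prob_aew_risk_ge_point_mass:
  fixes X :: "'a measure" and c :: "nat \<Rightarrow> real" and x0 :: 'a
  defines "P \<equiv> return (X \<Otimes>\<^sub>M unit_borel) (x0, 0)"
  assumes x0: "x0 \<in> space X" and "n \<noteq> 0"
    and ge: "r \<le> ((\<Sum>k=1..M. exp (- (real n / T) * (c k)\<^sup>2) * c k) /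
                  (\<Sum>k=1..M. exp (- (real n / T) * (c k)\<^sup>2)))\<^sup>2"
  shows "measure (iid_sample n P)
    {S \<in> space (iid_sample n P). r \<le> risk P (aew T n M (\<lambda>k _. c k) S)} = 1"
proof -
  have P: "prob_space P"
    unfolding P_def by (intro prob_space_return in_space_unit_borel_zero x0)
  have snd_meas[measurable]: "snd \<in> borel_measurable P"
    using measurable_snd_unit_borel[of X] by (simp add: P_def)
  interpret prob_space "iid_sample n P"
    unfolding iid_sample_def using P by (intro prob_space_PiM)
  have risk_eq: "risk P (aew T n M (\<lambda>k _. c k) S) = (aew T n M (\<lambda>k _. c k) S x0)\<^sup>2" for S
  proof -
    have "aew T n M (\<lambda>k _. c k) S = (\<lambda>_. aew T n M (\<lambda>k _. c k) S x0)"
      by (simp add: aew_def fun_eq_iff)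
    then show ?thesis
      unfolding P_def using risk_point_mass_const[OF x0] by metis
  qed
  have label_meas[measurable]: "(\<lambda>S. snd (S i)) \<in> borel_measurable (iid_sample n P)"
    if "i \<in> {1..n}" for i
    unfolding iid_sample_def
    by (rule measurable_compose[OF measurable_component_singleton[OF that] snd_meas])
  have "(\<lambda>S. emp_risk n S (\<lambda>_. c k)) \<in> borel_measurable (iid_sample n P)" for k
    unfolding emp_risk_def sq_loss_def
    by (intro borel_measurable_times borel_measurable_sum borel_measurable_power
        borel_measurable_diff borel_measurable_const label_meas)
  then have [measurable]:
    "(\<lambda>S. aew T n M (\<lambda>k _. c k) S x0) \<in> borel_measurable (iid_sample n P)"
    unfolding aew_def aew_weight_def by measurable
  have event: "{S \<in> space (iid_sample n P). r \<le> risk P (aew T n M (\<lambda>k _. c k) S)}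
      \<in> sets (iid_sample n P)"
    unfolding risk_eq by measurable
  have "AE z in P. snd z = 0"
  proof -
    have "Measurable.pred (X \<Otimes>\<^sub>M unit_borel) (\<lambda>z. snd z = 0)"
      using measurable_snd_unit_borel[of X] by measurable
    then show ?thesis
      unfolding P_def by (simp add: AE_return in_space_unit_borel_zero x0)
  qed
  then have "AE S in iid_sample n P. \<forall>i\<in>{1..n}. snd (S i) = 0"
    unfolding iid_sample_def
    by (intro AE_finite_allI AE_PiM_component[where P = "\<lambda>z. snd z = 0"]) (auto intro: P)
  then have "AE S in iid_sample n P. r \<le> risk P (aew T n M (\<lambda>k _. c k) S)"
  proof eventually_elim
    case (elim S)
    then show ?case
      unfolding risk_eq using aew_const_zero_labels[of n S T M c x0] \<open>n \<noteq> 0\<close> ge by simp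
  qed
  then show ?thesis
    using prob_Collect_eq_1[OF event] by simp
qed

lemma powr_neg_quarter_squared: "(x powr (-1/4))\<^sup>2 = 1 / sqrt x" if "0 < x" for x :: real
proof -
  have "(x powr (-1/4))\<^sup>2 = x powr (- (1/2))"
    by (simp add: power2_eq_square flip: powr_add)
  also have "\<dots> = 1 / sqrt x"
    using that by (simp add: powr_minus_divide powr_half_sqrt)
  finally show ?thesis .
qed

text \<open>
  The temperature bound is what makes the weight of a predictor with excess risk
  \<open>1 / sqrt n\<close> at least \<open>n powr (- 1 / c2)\<close>.
\<close>

lemma weight_lower_bound:
  fixes n c2 T :: real
  assumes "0 < c2" "1 < n" and T: "c2 * sqrt n / ln n \<le> T"
  shows "n powr (- 1 / c2) \<le> exp (- (n / T) * (n powr (-1/4))\<^sup>2)"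
proof -
  have ln: "0 < ln n" using \<open>1 < n\<close> by simp
  have "0 < c2 * sqrt n / ln n" using assms ln by simp
  then have "0 < T" using T by linarith
  have sq: "n * (n powr (-1/4))\<^sup>2 = sqrt n"
    using \<open>1 < n\<close> by (simp only: powr_neg_quarter_squared) (simp add: real_div_sqrt)
  have "n / T * (n powr (-1/4))\<^sup>2 = n * (n powr (-1/4))\<^sup>2 / T"
    by simp
  also have "\<dots> = sqrt n / T"
    by (simp only: sq)
  also have "\<dots> \<le> ln n / c2"
    using T ln \<open>0 < T\<close> \<open>0 < c2\<close> by (simp add: field_simps)
  finally show ?thesis
    using \<open>1 < n\<close> by (simp add: powr_def)
qed

theorem proposition2:
  fixes X :: "'a measure" and c2 T :: real and n :: nat
  assumes "space X \<noteq> {}"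
    and "c2 > 0"
    and "n \<ge> 2"
    and "T \<ge> c2 * sqrt (real n) / ln (real n)"
  shows "\<exists>(M::nat) (f :: nat \<Rightarrow> 'a \<Rightarrow> real) (P :: ('a \<times> real) measure).
           real M \<le> real n powr (1 / c2) + 2 \<and>
           dictionary X M f \<and>
           data_distribution X P \<and>
           measure (iid_sample n P)
             {S \<in> space (iid_sample n P).
                risk P (aew T n M f S)
                  \<ge> (MIN j\<in>{1..M}. risk P (f j)) + 1 / (4 * sqrt (real n))} = 1"
proof -
  define a where "a = real n powr (-1/4)"
  \<comment> \<open>One more than the floor, not the ceiling: the inequality \<open>n powr (1 / c2) < K\<close> must be strict.\<close>
  define K where "K = Suc (nat \<lfloor>real n powr (1 / c2)\<rfloor>)"
  have n: "1 < real n" using assms(3) by simp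
  have a: "0 < a" "a \<le> 1"
    using n powr_mono[of "-1/4" 0 "real n"] by (auto simp: a_def)
  have a_half: "(a / 2)\<^sup>2 = 1 / (4 * sqrt (real n))"
    using n powr_neg_quarter_squared[of "real n"] by (simp add: a_def power_divide)
  have "0 < c2 * sqrt (real n) / ln (real n)"
    using assms(2) n by simp
  then have "0 < T" using assms(4) by linarith
  have K_lower: "real n powr (1 / c2) < real K"
    unfolding K_def by linarith
  have "0 \<le> real n powr (1 / c2)" by simp
  then have K_upper: "real K \<le> real n powr (1 / c2) + 1"
    unfolding K_def by linarith
  have "1 = real n powr (1 / c2) * real n powr (- 1 / c2)"
    using n by (simp flip: powr_add)
  also have "\<dots> < real K * real n powr (- 1 / c2)"
    using K_lower n by (intro mult_strict_right_mono) auto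
  also have "\<dots> \<le> real K * exp (- (real n / T) * a\<^sup>2)"
    unfolding a_def using weight_lower_bound[OF assms(2) n assms(4)] by (intro mult_left_mono) auto
  finally have "1 < real K * exp (- (real n / T) * a\<^sup>2)" .
  then obtain c where c: "c 1 = 0" "inj_on c {1..Suc K}" "c ` {1..Suc K} \<subseteq> {0..a}"
    and average: "a / 2 \<le> (\<Sum>k=1..Suc K. exp (- (real n / T) * (c k)\<^sup>2) * c k) /
                          (\<Sum>k=1..Suc K. exp (- (real n / T) * (c k)\<^sup>2))"
    using bad_constants_exist[of a "real n / T" K] a \<open>0 < T\<close> by auto
  obtain x0 where x0: "x0 \<in> space X" using assms(1) by auto
  define P where "P = return (X \<Otimes>\<^sub>M unit_borel) (x0, 0)"
  define f where "f = (\<lambda>k (_::'a). c k)"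
  have "dictionary X (Suc K) f"
    unfolding dictionary_def
  proof (intro conjI ballI)
    fix k assume "k \<in> {1..Suc K}"
    then have "c k \<in> {0..1}" using c(3) a by force
    then show "f k \<in> X \<rightarrow>\<^sub>M unit_borel"
      unfolding f_def by (intro measurable_const) (simp add: unit_borel_def space_restrict_space)
  next
    show "inj_on (\<lambda>k. restrict (f k) (space X)) {1..Suc K}"
    proof (rule inj_onI)
      fix i j assume ij: "i \<in> {1..Suc K}" "j \<in> {1..Suc K}"
        "restrict (f i) (space X) = restrict (f j) (space X)"
      from fun_cong[OF ij(3), of x0] have "c i = c j" using x0 by (simp add: f_def)
      with c(2) ij show "i = j" by (auto dest: inj_onD)
    qed
  qed simp
  moreover have "data_distribution X P"
    unfolding data_distribution_def P_def
    by (simp add: prob_space_return in_space_unit_borel_zero x0)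
  moreover have "measure (iid_sample n P) {S \<in> space (iid_sample n P).
      (MIN j\<in>{1..Suc K}. risk P (f j)) + 1 / (4 * sqrt (real n)) \<le> risk P (aew T n (Suc K) f S)} = 1"
    unfolding P_def f_def
  proof (rule prob_aew_risk_ge_point_mass)
    have "(MIN j\<in>{1..Suc K}. risk P (f j)) \<le> risk P (f 1)"
      by (intro Min_le) auto
    also have "\<dots> = 0"
      unfolding P_def f_def using risk_point_mass_const[OF x0] c(1) by simp
    finally have "(MIN j\<in>{1..Suc K}. risk P (f j)) + 1 / (4 * sqrt (real n)) \<le> (a / 2)\<^sup>2"
      by (simp add: a_half)
    also have "\<dots> \<le> ((\<Sum>k=1..Suc K. exp (- (real n / T) * (c k)\<^sup>2) * c k) /
                     (\<Sum>k=1..Suc K. exp (- (real n / T) * (c k)\<^sup>2)))\<^sup>2"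
      using average a by (intro power_mono) auto
    finally show "(MIN j\<in>{1..Suc K}. risk (return (X \<Otimes>\<^sub>M unit_borel) (x0, 0)) (\<lambda>_. c j)) +
        1 / (4 * sqrt (real n)) \<le> ((\<Sum>k=1..Suc K. exp (- (real n / T) * (c k)\<^sup>2) * c k) /
                     (\<Sum>k=1..Suc K. exp (- (real n / T) * (c k)\<^sup>2)))\<^sup>2"
      unfolding P_def f_def .
  qed (use x0 assms(3) in auto)
  moreover have "real (Suc K) \<le> real n powr (1 / c2) + 2"
    using K_upper by simp
  ultimately show ?thesis by blast
qed

end
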